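(* Let $\|\cdot\|$ be an $\mathrm{Ad}$-invariant Finsler norm on $\mathfrak{u}_n$. Let $0\ne V=i\sum_{k} v_kP_k\in\mathfrak{u}_n$, with $v_1>v_2>\dots$ the distinct eigenvalues of $-iV$ and $P_k$ the orthogonal projections onto the corresponding eigenspaces. Let $\varphi=(N|\,\cdot\,)$ be a norming functional for $V$, write $N=i\sum_k N_k$ with $N_k$ the self-adjoint blocks of $-iN$ (so $N_k=P_kN_kP_k$, regarded as an operator on $\mathrm{Ran}(P_k)$), and let $F_\varphi$ be the face given by $\varphi$. Then: 1. If $j>k$, any eigenvalue of $N_k$ is greater than or equal to all the eigenvalues of $N_j$. 2. If $j>k$ and an eigenvalue of $N_k$ is equal to an eigenvalue of $N_j$, then permuting the corresponding one-dimensional projections gives another element of $F_\varphi$: if $e\in\mathrm{Ran}(P_k)$ and $f\in\mathrm{Ran}(P_j)$ are unit eigenvectors of $N_k$ and $N_j$ for these equal eigenvalues and $U$ is the unitary exchanging $e$ and $f$ and equal to the identity on $\{e,f\}^\perp$, then $\tilde V=UVU^*\neq V$ and $\tilde V\in F_\varphi$. 3. If $F_\varphi=\{V\}$, then the inequality in item 1 is always strict. 4. For given $s$, exchanging one-dimensional eigenprojections of $N_s$ corresponding to different eigenvalues gives another norming functional for $V$: if $e,f\in\mathrm{Ran}(P_s)$ are unit eigenvectors of $N_s$ for different eigenvalues and $U$ is the unitary exchanging $e$ and $f$ and equal to the identity on $\{e,f\}^\perp$, then $\phi=(UNU^*|\,\cdot\,)\ne\varphi$ is norming for $V$. 5. If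 $\varphi$ is the unique norming functional for $V$, then $N$ is diagonal with respect to $V$, i.e. $N=i\sum_k n_kP_k$ with $n_k\in\mathbb{R}$, and $n_k\ge n_{k+1}$ for all $k$. In particular, if the norm is strictly convex and smooth, then $N=i\sum_k n_kP_k$ with the $n_k$ strictly decreasing in $k$.
   Context: $\mathfrak{u}_n$ is the real vector space of $n\times n$ complex skew-Hermitian matrices and $\mathbf{U}_n$ the group of $n\times n$ unitary matrices. An $\mathrm{Ad}$-invariant Finsler norm on $\mathfrak{u}_n$ is a function $\|\cdot\|:\mathfrak{u}_n\to\mathbb{R}_{\ge 0}$ such that for all $X,Y\in\mathfrak{u}_n$: $\|X\|=0$ iff $X=0$; $\|X+Y\|\le\|X\|+\|Y\|$; $\|\lambda X\|=\lambda\|X\|$ for all real $\lambda\ge 0$ (full homogeneity is not required); $\|UXU^*\|=\|X\|$ for all $U\in\mathbf{U}_n$. The trace inner product on $\mathfrak{u}_n$ is $(A|B)=\mathrm{Tr}(AB^* )=-\mathrm{Tr}(AB)$; every real linear functional on $\mathfrak{u}_n$ is $\varphi=(N|\,\cdot\,)$ for a unique $N\in\mathfrak{u}_n$. The norm of a functional is $\|\varphi\|=\max\{\varphi(Y):\|Y\|\le 1\}$ (no absolute value). A norming functional for $V$ is a linear functional $\varphi$ with $\|\varphi\|=1$ and $\varphi(V)=\|V\|$. For a norming functional $\varphi$ of $V$, the face is $F_\varphi=\{Y\in\mathfrak{u}_n:\|Y\|\le\|V\|,\ \varphi(Y)=\|V\|\}$. If $\varphi=(N|\,\cdot\,)$ is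 norming for $V$ then $N$ commutes with $V$, so that $N=i\sum_kN_k$ with $N_k=P_kN_kP_k$ self-adjoint; here $\sum_kP_k=1$. The norm is strictly convex if every vector of its unit sphere is an extreme point of the closed unit ball; it is smooth if it is (Gâteaux) differentiable at every $X\neq 0$, equivalently every $X\ne0$ has a unique norming functional. *)

theory Defs
  imports "HOL-Analysis.Analysis"
begin

definition cmat_scale :: "complex \<Rightarrow> complex^'n^'m \<Rightarrow> complex^'n^'m" (infixr \<open>*\<^sub>M\<close> 75)
  where "c *\<^sub>M A = map_matrix (\<lambda>z. c * z) A"

definition conj_transpose :: "complex^'n^'m \<Rightarrow> complex^'m^'n"
  where "conj_transpose A = map_matrix cnj (transpose A)"

definition skew_hermitian :: "(complex^'n^'n) set"
  where "skew_hermitian = {A. conj_transpose A = - A}"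

definition unitary :: "complex^'n^'n \<Rightarrow> bool"
  where "unitary U \<longleftrightarrow> U ** conj_transpose U = mat 1 \<and> conj_transpose U ** U = mat 1"

text \<open>The library inner product on \<^typ>\<open>complex^'n\<close> is the real part of this Hermitian one, so
  the library's orthogonality is weaker than Hermitian orthogonality.  The library norm is the
  Hermitian norm.\<close>

definition hermitian_inner :: "complex^'n \<Rightarrow> complex^'n \<Rightarrow> complex"
  where "hermitian_inner x y = (\<Sum>i\<in>UNIV. x $ i * cnj (y $ i))"

text \<open>For skew-Hermitian arguments the trace is already real.\<close>

definition trace_inner :: "complex^'n^'n \<Rightarrow> complex^'n^'n \<Rightarrow> real"
  where "trace_inner A B = Re (trace (A ** conj_transpose B))"

text \<open>Norms and functionals on \<^const>\<open>skew_hermitian\<close> are functions on all matrices of which only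
  the values on \<^const>\<open>skew_hermitian\<close> matter.\<close>

definition Ad_invariant_Finsler_norm :: "(complex^'n^'n \<Rightarrow> real) \<Rightarrow> bool"
  where "Ad_invariant_Finsler_norm nrm \<longleftrightarrow>
    (\<forall>X\<in>skew_hermitian. 0 \<le> nrm X) \<and>
    (\<forall>X\<in>skew_hermitian. nrm X = 0 \<longleftrightarrow> X = 0) \<and>
    (\<forall>X\<in>skew_hermitian. \<forall>Y\<in>skew_hermitian. nrm (X + Y) \<le> nrm X + nrm Y) \<and>
    (\<forall>X\<in>skew_hermitian. \<forall>l\<ge>0. nrm (l *\<^sub>R X) = l * nrm X) \<and>
    (\<forall>X\<in>skew_hermitian. \<forall>U. unitary U \<longrightarrow> nrm (U ** X ** conj_transpose U) = nrm X)"

definition linear_functional :: "(complex^'n^'n \<Rightarrow> real) \<Rightarrow> bool"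
  where "linear_functional \<phi> \<longleftrightarrow>
    (\<forall>X\<in>skew_hermitian. \<forall>Y\<in>skew_hermitian. \<phi> (X + Y) = \<phi> X + \<phi> Y) \<and>
    (\<forall>X\<in>skew_hermitian. \<forall>c. \<phi> (c *\<^sub>R X) = c * \<phi> X)"

text \<open>\<open>r\<close> is the maximum of \<open>\<phi>\<close> on the closed unit ball; no absolute value is taken.\<close>

definition has_functional_norm ::
  "(complex^'n^'n \<Rightarrow> real) \<Rightarrow> (complex^'n^'n \<Rightarrow> real) \<Rightarrow> real \<Rightarrow> bool"
  where "has_functional_norm nrm \<phi> r \<longleftrightarrow>
    (\<exists>Y\<in>skew_hermitian. nrm Y \<le> 1 \<and> \<phi> Y = r) \<and>
    (\<forall>Y\<in>skew_hermitian. nrm Y \<le> 1 \<longrightarrow> \<phi> Y \<le> r)"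

definition norming_functional ::
  "(complex^'n^'n \<Rightarrow> real) \<Rightarrow> (complex^'n^'n \<Rightarrow> real) \<Rightarrow> complex^'n^'n \<Rightarrow> bool"
  where "norming_functional nrm \<phi> V \<longleftrightarrow>
    linear_functional \<phi> \<and> has_functional_norm nrm \<phi> 1 \<and> \<phi> V = nrm V"

definition face ::
  "(complex^'n^'n \<Rightarrow> real) \<Rightarrow> (complex^'n^'n \<Rightarrow> real) \<Rightarrow> complex^'n^'n \<Rightarrow> (complex^'n^'n) set"
  where "face nrm \<phi> V = {Y\<in>skew_hermitian. nrm Y \<le> nrm V \<and> \<phi> Y = nrm V}"

definition strictly_convex_norm :: "(complex^'n^'n \<Rightarrow> real) \<Rightarrow> bool"
  where "strictly_convex_norm nrm \<longleftrightarrow>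
    (\<forall>X\<in>skew_hermitian. nrm X = 1 \<longrightarrow> X extreme_point_of {Y\<in>skew_hermitian. nrm Y \<le> 1})"

text \<open>Gateaux differentiability: two-sided directional derivatives, linear in the direction.\<close>

definition smooth_norm :: "(complex^'n^'n \<Rightarrow> real) \<Rightarrow> bool"
  where "smooth_norm nrm \<longleftrightarrow>
    (\<forall>X\<in>skew_hermitian. X \<noteq> 0 \<longrightarrow>
      (\<exists>D. linear_functional D \<and>
        (\<forall>Y\<in>skew_hermitian. ((\<lambda>t. nrm (X + t *\<^sub>R Y)) has_real_derivative D Y) (at 0))))"

definition eigenvector_on :: "(complex^'n) set \<Rightarrow> complex^'n^'n \<Rightarrow> complex \<Rightarrow> complex^'n \<Rightarrow> bool"
  where "eigenvector_on S A c x \<longleftrightarrow> x \<in> S \<and> x \<noteq> 0 \<and> A *v x = c *s x"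

definition eigenvalue_on :: "(complex^'n) set \<Rightarrow> complex^'n^'n \<Rightarrow> complex \<Rightarrow> bool"
  where "eigenvalue_on S A c \<longleftrightarrow> (\<exists>x. eigenvector_on S A c x)"

definition Ran :: "complex^'n^'n \<Rightarrow> (complex^'n) set"
  where "Ran A = range (\<lambda>x. A *v x)"

definition orthogonal_projection_onto :: "(complex^'n) set \<Rightarrow> complex^'n^'n \<Rightarrow> bool"
  where "orthogonal_projection_onto S P \<longleftrightarrow> P ** P = P \<and> conj_transpose P = P \<and> Ran P = S"

text \<open>\<open>V = \<i> \<Sum>\<^sub>k v\<^sub>k P\<^sub>k\<close> where \<open>v\<^sub>1 > \<dots> > v\<^sub>m\<close> lists the eigenvalues of \<open>- \<i> V\<close> and
  \<open>P\<^sub>k\<close> is the orthogonal projection onto the \<open>v\<^sub>k\<close>-eigenspace.\<close>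

definition spectral_decomposition ::
  "complex^'n^'n \<Rightarrow> nat \<Rightarrow> (nat \<Rightarrow> real) \<Rightarrow> (nat \<Rightarrow> complex^'n^'n) \<Rightarrow> bool"
  where "spectral_decomposition V m v P \<longleftrightarrow>
    (\<forall>k\<in>{1..m}. \<forall>j\<in>{1..m}. k < j \<longrightarrow> v k > v j) \<and>
    {c. eigenvalue_on UNIV ((- \<i>) *\<^sub>M V) c} = (\<lambda>k. complex_of_real (v k)) ` {1..m} \<and>
    (\<forall>k\<in>{1..m}. orthogonal_projection_onto
      {x. ((- \<i>) *\<^sub>M V) *v x = complex_of_real (v k) *s x} (P k)) \<and>
    V = \<i> *\<^sub>M (\<Sum>k=1..m. v k *\<^sub>R P k)"

text \<open>The block of \<open>- \<i> N\<close> on \<open>Ran P\<close>, i.e.\ \<open>P (- \<i> N) P\<close>.\<close>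

definition block :: "complex^'n^'n \<Rightarrow> complex^'n^'n \<Rightarrow> complex^'n^'n"
  where "block N P = P ** ((- \<i>) *\<^sub>M N) ** P"

definition exchanges :: "complex^'n^'n \<Rightarrow> complex^'n \<Rightarrow> complex^'n \<Rightarrow> bool"
  where "exchanges U e f \<longleftrightarrow> unitary U \<and> U *v e = f \<and> U *v f = e \<and>
    (\<forall>x. hermitian_inner x e = 0 \<and> hermitian_inner x f = 0 \<longrightarrow> U *v x = x)"

text \<open>For orthonormal \<open>e\<close> and \<open>f\<close> the exchanging unitary exists and is unique, so
  quantifying over all such unitaries is quantifying over exactly one.\<close>

lemma exchanges_ex1:
  fixes e f :: "complex^'n"
  assumes e: "norm e = 1" and f: "norm f = 1" and ef: "hermitian_inner e f = 0"
  shows "\<exists>!U. exchanges U e f"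
proof -
  have nrm: "hermitian_inner x x = 1" if "norm x = 1" for x :: "complex^'n"
  proof -
    have "hermitian_inner x x = (\<Sum>i\<in>UNIV. complex_of_real ((norm (x $ i))\<^sup>2))"
      unfolding hermitian_inner_def by (simp add: complex_norm_square[symmetric])
    also have "\<dots> = complex_of_real ((norm x)\<^sup>2)"
      by (simp add: norm_vec_def L2_set_def sum_nonneg)
    finally show ?thesis using that by simp
  qed
  have sym: "hermitian_inner y x = cnj (hermitian_inner x y)" for x y :: "complex^'n"
    by (simp add: hermitian_inner_def mult.commute)
  have fe: "hermitian_inner f e = 0" using ef sym[of f e] by simp
  have diffl: "hermitian_inner (x - y) z = hermitian_inner x z - hermitian_inner y z"
    and diffr: "hermitian_inner z (x - y) = hermitian_inner z x - hermitian_inner z y"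
    and scl: "hermitian_inner (c *s x) z = c * hermitian_inner x z" for x y z :: "complex^'n" and c
    by (simp_all add: hermitian_inner_def algebra_simps sum_subtractf sum_distrib_left)
  define w where "w = e - f"
  have ww: "hermitian_inner w w = 2"
    by (simp add: w_def diffl diffr nrm e f ef fe)
  define U :: "complex^'n^'n" where "U = (\<chi> r s. (if r = s then 1 else 0) - w $ r * cnj (w $ s))"
  have Uv: "U *v x = x - hermitian_inner x w *s w" for x
  proof -
    have "(U *v x) $ i = x $ i - hermitian_inner x w * w $ i" for i
    proof -
      have "(U *v x) $ i = (\<Sum>j\<in>UNIV. (if i = j then x $ j else 0) - w $ i * (x $ j * cnj (w $ j)))"
        unfolding U_def matrix_vector_mult_def
        by (simp, intro sum.cong refl, simp add: algebra_simps)
      also have "\<dots> = x $ i - w $ i * hermitian_inner x w"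
        by (simp add: sum_subtractf sum_distrib_left hermitian_inner_def)
      finally show ?thesis by (simp add: mult.commute)
    qed
    then show ?thesis by (simp add: vec_eq_iff)
  qed
  have adj: "conj_transpose U = U"
    by (simp add: conj_transpose_def U_def vec_eq_iff transpose_def mult.commute)
  have "(U ** U) *v x = mat 1 *v x" for x
    by (simp only: matrix_vector_mul_assoc[symmetric] Uv)
       (simp add: diffl scl ww vec_eq_iff algebra_simps)
  then have UU: "U ** U = mat 1" by (simp add: matrix_eq)
  have "exchanges U e f"
    unfolding exchanges_def unitary_def adj
  proof (intro conjI allI impI)
    show "U ** U = mat 1" "U ** U = mat 1" by (fact UU)+
    have "hermitian_inner e w = 1" "hermitian_inner f w = - 1"
      by (simp_all add: w_def diffr nrm e f ef fe)
    then show "U *v e = f" "U *v f = e"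
      by (simp_all add: Uv vec_eq_iff) (simp_all add: w_def)
    show "U *v x = x" if "hermitian_inner x e = 0 \<and> hermitian_inner x f = 0" for x
      using that by (simp add: Uv w_def diffr)
  qed
  moreover have "W = W'" if W: "exchanges W e f" and W': "exchanges W' e f" for W W'
  proof -
    have "W *v x = W' *v x" for x
    proof -
      define z where "z = x - hermitian_inner x e *s e - hermitian_inner x f *s f"
      have "hermitian_inner z e = 0" "hermitian_inner z f = 0"
        by (simp_all add: z_def diffl scl nrm e f ef fe)
      then have "W *v z = W' *v z" using W W' by (simp add: exchanges_def)
      moreover have "A *v x = A *v z + hermitian_inner x e *s (A *v e) + hermitian_inner x f *s (A *v f)"
        for A :: "complex^'n^'n"
        by (simp add: z_def matrix_vector_mult_diff_distrib vector_scalar_commute[symmetric])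
      moreover have "W *v e = W' *v e" "W *v f = W' *v f"
        using W W' by (simp_all add: exchanges_def)
      ultimately show ?thesis by simp
    qed
    then show ?thesis by (simp add: matrix_eq)
  qed
  ultimately show ?thesis by blast
qed

end

theory Submission
  imports Defs
begin

text \<open>Among all \<open>U V U\<^sup>*\<close>, which have the same norm as \<open>V\<close>, a norming functional \<open>(N|\<cdot>)\<close> is
  largest at \<open>V\<close> itself.  It suffices to test this with the Householder reflections
  \<open>U = 1 - 2 w w\<^sup>* / |w|\<^sup>2\<close>, for which maximality becomes a polynomial inequality in \<open>w\<close> involving only
  \<open>V w\<close> and \<open>N w\<close>.  Taking \<open>w = e + t f\<close> with \<open>e\<close>, \<open>f\<close> in different eigenspaces of \<open>V\<close>, the limit
  \<open>t \<rightarrow> 0\<close> shows that \<open>N\<close> is block diagonal, and \<open>t = 1\<close> orders the eigenvalues of the blocks.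
  The unitary exchanging orthonormal \<open>e\<close> and \<open>f\<close> is the reflection in \<open>e - f\<close>, so it fixes every
  skew-Hermitian matrix with \<open>e\<close> and \<open>f\<close> as eigenvectors for one common eigenvalue: this applies
  to \<open>N\<close> in item 2 and to \<open>V\<close> in item 4.\<close>


subsection \<open>Hermitian inner product and adjoints\<close>

lemma hermitian_inner_simps:
  "hermitian_inner (x + y) z = hermitian_inner x z + hermitian_inner y z"
  "hermitian_inner (x - y) z = hermitian_inner x z - hermitian_inner y z"
  "hermitian_inner (- x) z = - hermitian_inner x z"
  "hermitian_inner (c *s x) z = c * hermitian_inner x z"
  "hermitian_inner 0 z = 0"
  "hermitian_inner z (x + y) = hermitian_inner z x + hermitian_inner z y"
  "hermitian_inner z (x - y) = hermitian_inner z x - hermitian_inner z y"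
  "hermitian_inner z (- x) = - hermitian_inner z x"
  "hermitian_inner z (c *s x) = cnj c * hermitian_inner z x"
  "hermitian_inner z 0 = 0"
  by (simp_all add: hermitian_inner_def sum.distrib sum_subtractf sum_negf sum_distrib_left
      algebra_simps)

lemma hermitian_inner_commute: "hermitian_inner y x = cnj (hermitian_inner x y)"
  by (simp add: hermitian_inner_def mult.commute)

lemma hermitian_inner_self: "hermitian_inner x x = complex_of_real ((norm x)\<^sup>2)"
proof -
  have "hermitian_inner x x = (\<Sum>i\<in>UNIV. complex_of_real ((norm (x $ i))\<^sup>2))"
    unfolding hermitian_inner_def by (simp add: complex_norm_square[symmetric])
  also have "\<dots> = complex_of_real ((norm x)\<^sup>2)"
    by (simp add: norm_vec_def L2_set_def sum_nonneg)
  finally show ?thesis .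
qed

lemma hermitian_inner_ext:
  assumes "\<And>y. hermitian_inner x y = hermitian_inner x' y"
  shows "x = x'"
proof -
  have "hermitian_inner (x - x') (x - x') = 0"
    by (subst hermitian_inner_simps(2)) (simp add: assms)
  then show ?thesis by (simp add: hermitian_inner_self)
qed

lemma hermitian_inner_conj_transpose:
  "hermitian_inner (A *v x) y = hermitian_inner x (conj_transpose A *v y)"
proof -
  have "hermitian_inner (A *v x) y = (\<Sum>i\<in>UNIV. \<Sum>j\<in>UNIV. A $ i $ j * x $ j * cnj (y $ i))"
    by (simp add: hermitian_inner_def matrix_vector_mult_def sum_distrib_right)
  also have "\<dots> = (\<Sum>j\<in>UNIV. \<Sum>i\<in>UNIV. A $ i $ j * x $ j * cnj (y $ i))"
    by (rule sum.swap)
  also have "\<dots> = hermitian_inner x (conj_transpose A *v y)"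
    by (simp add: hermitian_inner_def matrix_vector_mult_def conj_transpose_def transpose_def
        sum_distrib_left mult_ac)
  finally show ?thesis .
qed

lemma conj_transpose_simps [simp]:
  "conj_transpose (conj_transpose A) = A"
  "conj_transpose (A + B) = conj_transpose A + conj_transpose B"
  "conj_transpose (A - B) = conj_transpose A - conj_transpose B"
  "conj_transpose (- A) = - conj_transpose A"
  "conj_transpose (r *\<^sub>R A) = r *\<^sub>R conj_transpose A"
  "conj_transpose (mat 1 :: complex^'n^'n) = mat 1"
  by (simp_all add: conj_transpose_def transpose_def vec_eq_iff mat_def)

lemma conj_transpose_mult: "conj_transpose (A ** B) = conj_transpose B ** conj_transpose A"
  by (simp add: conj_transpose_def transpose_def vec_eq_iff matrix_matrix_mult_def mult.commute)

lemma matrix_minus_vector_mult: "(- A) *v x = - (A *v (x :: complex^'n))"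
  by (simp add: matrix_vector_mult_def vec_eq_iff sum_negf)

lemma matrix_vector_mult_minus: "A *v (- x) = - (A *v (x :: complex^'n))"
  by (simp add: matrix_vector_mult_def vec_eq_iff sum_negf)

lemma sum_matrix_vector_mult:
  "(\<Sum>k\<in>I. A k) *v (x :: complex^'n) = (\<Sum>k\<in>I. A k *v x)"
  by (induction I rule: infinite_finite_induct) (simp_all add: matrix_vector_mult_add_rdistrib)

lemma matrix_vector_mult_sum:
  "A *v (\<Sum>k\<in>I. x k) = (\<Sum>k\<in>I. A *v (x k :: complex^'n))"
  by (induction I rule: infinite_finite_induct) (simp_all add: matrix_vector_right_distrib)

lemma scaleR_matrix_vector: "(r *\<^sub>R A) *v (x :: complex^'n) = complex_of_real r *s (A *v x)"
  by (simp add: matrix_vector_mult_def vec_eq_iff) (simp add: scaleR_conv_of_real sum_distrib_left)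

lemma cmat_scale_vector: "(c *\<^sub>M A) *v x = c *s (A *v x)"
  by (simp add: cmat_scale_def matrix_vector_mult_def vec_eq_iff sum_distrib_left mult.assoc)

lemma unitary_conj_transpose: "unitary U \<Longrightarrow> unitary (conj_transpose U)"
  by (simp add: unitary_def)

lemma unitary_conjugation_eq_iff:
  assumes "unitary U"
  shows "U ** A ** conj_transpose U = A \<longleftrightarrow> U ** A = A ** U"
proof
  assume "U ** A ** conj_transpose U = A"
  then have "A ** U = U ** A ** (conj_transpose U ** U)"
    by (metis matrix_mul_assoc)
  then show "U ** A = A ** U" using assms by (simp add: unitary_def)
next
  assume "U ** A = A ** U"
  then have "U ** A ** conj_transpose U = A ** (U ** conj_transpose U)"
    by (simp add: matrix_mul_assoc)
  then show "U ** A ** conj_transpose U = A" using assms by (simp add: unitary_def)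
qed

lemma hermitian_inner_skew_hermitian:
  assumes "A \<in> skew_hermitian"
  shows "hermitian_inner (A *v x) y = - hermitian_inner x (A *v y)"
  using assms
  by (simp add: hermitian_inner_conj_transpose skew_hermitian_def matrix_minus_vector_mult
      hermitian_inner_simps)

lemma skew_hermitian_closed [simp]:
  "A \<in> skew_hermitian \<Longrightarrow> B \<in> skew_hermitian \<Longrightarrow> A + B \<in> skew_hermitian"
  "A \<in> skew_hermitian \<Longrightarrow> B \<in> skew_hermitian \<Longrightarrow> A - B \<in> skew_hermitian"
  "A \<in> skew_hermitian \<Longrightarrow> r *\<^sub>R A \<in> skew_hermitian"
  by (simp_all add: skew_hermitian_def)

lemma skew_hermitian_conjugation:
  assumes "A \<in> skew_hermitian"
  shows "U ** A ** conj_transpose U \<in> skew_hermitian"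
proof -
  have "U ** (- A) ** conj_transpose U = - (U ** A ** conj_transpose U)"
    by (simp add: matrix_eq matrix_vector_mul_assoc[symmetric] matrix_minus_vector_mult
        matrix_vector_mult_minus)
  then show ?thesis
    using assms by (simp add: skew_hermitian_def conj_transpose_mult matrix_mul_assoc)
qed

text \<open>Moving \<open>A\<close> across the inner product gives
  \<open>i a <e, f> = i b <e, f>\<close>, where \<open><x, y>\<close> stands for
  \<open>hermitian_inner x y\<close>.\<close>

lemma skew_hermitian_eigenvectors_orthogonal:
  assumes "A \<in> skew_hermitian"
    and "A *v e = (\<i> * complex_of_real a) *s e" and "A *v f = (\<i> * complex_of_real b) *s f"
    and "a \<noteq> b"
  shows "hermitian_inner e f = 0"
  using hermitian_inner_skew_hermitian[OF assms(1), of e f] assms(4)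
  by (simp add: assms(2,3) hermitian_inner_simps)

text \<open>Gives access to the library inner product on matrices, whose definiteness later turns
  equal functionals into equal matrices.\<close>

lemma trace_inner_eq_inner: "trace_inner A B = A \<bullet> B"
  by (simp add: trace_inner_def trace_def matrix_matrix_mult_def conj_transpose_def transpose_def
      inner_vec_def inner_complex_def)

lemma trace_inner_conjugation:
  "trace_inner (U ** A ** conj_transpose U) B = trace_inner A (conj_transpose U ** B ** U)"
proof -
  have "trace (U ** A ** conj_transpose U ** conj_transpose B)
      = trace (U ** (A ** conj_transpose U ** conj_transpose B))"
    by (simp add: matrix_mul_assoc)
  also have "\<dots> = trace (A ** conj_transpose U ** conj_transpose B ** U)"
    by (rule trace_mul_sym)
  finally show ?thesis
    by (simp add: trace_inner_def conj_transpose_mult matrix_mul_assoc)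
qed

subsection \<open>Householder reflections\<close>

definition outer :: "complex^'m \<Rightarrow> complex^'n \<Rightarrow> complex^'n^'m"
  where "outer x y = (\<chi> i j. x $ i * cnj (y $ j))"

lemma outer_vector: "outer x y *v z = hermitian_inner z y *s x"
  by (simp add: outer_def matrix_vector_mult_def vec_eq_iff hermitian_inner_def sum_distrib_left
      mult_ac)

text \<open>Used to pair \<open>N\<close> term by term with the rank-one corrections in a conjugate
  of \<open>V\<close>.\<close>

lemma inner_outer: "A \<bullet> outer x y = Re (hermitian_inner (A *v y) x)"
  by (simp add: inner_vec_def outer_def hermitian_inner_def matrix_vector_mult_def
      inner_complex_def sum_distrib_left algebra_simps sum.distrib sum_subtractf)

text \<open>The reflection in the complex hyperplane orthogonal to \<open>w\<close>. Division by
  zero gives 0, so \<open>householder 0\<close> is the identity.\<close>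

definition householder :: "complex^'n \<Rightarrow> complex^'n^'n"
  where "householder w = mat 1 - (2 / (norm w)\<^sup>2) *\<^sub>R outer w w"

lemma householder_vector:
  "householder w *v x = x - (complex_of_real (2 / (norm w)\<^sup>2) * hermitian_inner x w) *s w"
  by (simp add: householder_def matrix_vector_mult_diff_rdistrib scaleR_matrix_vector outer_vector
      vector_smult_assoc)

lemma conj_transpose_householder: "conj_transpose (householder w) = householder w"
  by (simp add: householder_def)
     (simp add: conj_transpose_def outer_def transpose_def vec_eq_iff mult.commute)

lemma householder_involution:
  assumes "w \<noteq> 0"
  shows "householder w ** householder w = mat 1"
proof -
  have "householder w *v (householder w *v x) = x" for x
    using assms
    by (simp add: householder_vector hermitian_inner_simps hermitian_inner_self vec_eq_iff
        field_simps)
  then show ?thesis by (simp add: matrix_eq matrix_vector_mul_assoc[symmetric])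
qed

lemma unitary_householder: "w \<noteq> 0 \<Longrightarrow> unitary (householder w)"
  by (simp add: unitary_def conj_transpose_householder householder_involution)

text \<open>Since \<open><A x, w> = - <x, A w> = i r <x, w>\<close>, \<open>A\<close> commutes with
  \<open>outer w w\<close> and hence with the reflection.\<close>

lemma householder_conjugation_eq:
  assumes "A \<in> skew_hermitian" and "A *v w = (\<i> * complex_of_real r) *s w" and "w \<noteq> 0"
  shows "householder w ** A ** conj_transpose (householder w) = A"
proof -
  have "householder w *v (A *v x) = A *v (householder w *v x)" for x
    by (simp add: householder_vector hermitian_inner_skew_hermitian[OF assms(1)] assms(2)
        matrix_vector_mult_diff_distrib vector_scalar_commute hermitian_inner_simps
        vector_smult_assoc mult_ac)
  then have "householder w ** A = A ** householder w"
    by (simp add: matrix_eq matrix_vector_mul_assoc[symmetric])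
  then show ?thesis using unitary_conjugation_eq_iff unitary_householder assms(3) by blast
qed

text \<open>As \<open>e - f\<close> has squared norm 2, the reflection in it meets the specification
  \<open>exchanges\<close>; \<open>exchanges_ex1\<close> supplies uniqueness.\<close>

lemma exchanges_eq_householder:
  assumes "norm e = 1" "norm f = 1" "hermitian_inner e f = 0" "exchanges U e f"
  shows "U = householder (e - f)" and "e - f \<noteq> 0"
proof -
  have ee: "hermitian_inner e e = 1" and ff: "hermitian_inner f f = 1"
    by (simp_all add: hermitian_inner_self assms)
  have fe: "hermitian_inner f e = 0"
    using assms(3) hermitian_inner_commute[of f e] by simp
  have "complex_of_real ((norm (e - f))\<^sup>2) = 2"
    by (simp only: hermitian_inner_self[symmetric])
       (simp add: hermitian_inner_simps ee ff assms(3) fe)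
  then have n2: "(norm (e - f))\<^sup>2 = 2"
    by (metis of_real_eq_iff of_real_numeral)
  then show ne: "e - f \<noteq> 0" by auto
  have "exchanges (householder (e - f)) e f"
    by (simp add: exchanges_def unitary_householder[OF ne] householder_vector n2
        hermitian_inner_simps ee ff assms(3) fe)
  then show "U = householder (e - f)"
    using exchanges_ex1[OF assms(1-3)] assms(4) by blast
qed

lemma exchanges_conjugation_eq:
  assumes "A \<in> skew_hermitian"
    and "A *v e = (\<i> * complex_of_real r) *s e" and "A *v f = (\<i> * complex_of_real r) *s f"
    and "norm e = 1" "norm f = 1" "hermitian_inner e f = 0" "exchanges U e f"
  shows "U ** A ** conj_transpose U = A"
proof -
  have "A *v (e - f) = (\<i> * complex_of_real r) *s (e - f)"
    using assms(2,3) by (simp add: matrix_vector_mult_diff_distrib vector_ssub_ldistrib)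
  then show ?thesis
    using householder_conjugation_eq[OF assms(1)] exchanges_eq_householder[OF assms(4-7)] by simp
qed

text \<open>Were \<open>A\<close> fixed, it would commute with \<open>U\<close>; evaluated at
  \<open>e\<close>, this reads \<open>c *s f = d *s f\<close>.\<close>

lemma exchanges_conjugation_neq:
  assumes "A *v e = c *s e" and "A *v f = d *s f" and "c \<noteq> d" and "norm f = 1"
    and "exchanges U e f"
  shows "U ** A ** conj_transpose U \<noteq> A"
proof
  assume "U ** A ** conj_transpose U = A"
  then have "U ** A = A ** U"
    using assms(5) unitary_conjugation_eq_iff by (auto simp: exchanges_def)
  then have "U *v (A *v e) = A *v (U *v e)"
    by (simp add: matrix_vector_mul_assoc)
  then have "c *s f = d *s f"
    using assms(1,2,5) by (simp add: exchanges_def vector_scalar_commute)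
  then show False using assms(3,4) by auto
qed

text \<open>Multiply out the conjugation with \<open>1 - c w w^*\<close>: the corrections to
  \<open>V\<close> are rank-one matrices built from \<open>w\<close> and \<open>V w\<close>, so
  pairing with \<open>N\<close> involves \<open>V w\<close> and \<open>N w\<close> only.\<close>

lemma inner_householder_conjugation:
  fixes N V :: "complex^'n^'n" and w :: "complex^'n"
  assumes N: "N \<in> skew_hermitian" and V: "V \<in> skew_hermitian"
  defines "c \<equiv> 2 / (norm w)\<^sup>2"
  shows "N \<bullet> (householder w ** V ** conj_transpose (householder w)) = N \<bullet> V
    - 2 * c * Re (hermitian_inner (N *v w) (V *v w))
    + c\<^sup>2 * Re (cnj (hermitian_inner (V *v w) w) * hermitian_inner (N *v w) w)"
proof -
  have "householder w ** V ** conj_transpose (householder w) = V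
    + c *\<^sub>R outer w (V *v w) - c *\<^sub>R outer (V *v w) w
    + c\<^sup>2 *\<^sub>R outer (hermitian_inner (V *v w) w *s w) w"
    unfolding conj_transpose_householder
    by (simp add: matrix_eq matrix_vector_mul_assoc[symmetric] matrix_vector_mult_diff_rdistrib
        matrix_vector_mult_add_rdistrib householder_vector matrix_vector_mult_diff_distrib
        vector_scalar_commute scaleR_matrix_vector outer_vector hermitian_inner_simps
        hermitian_inner_skew_hermitian[OF V, of _ w] c_def[symmetric] del: of_real_divide)
       (simp add: vec_eq_iff algebra_simps power2_eq_square)
  \<comment> \<open>This makes the two terms linear in \<open>c\<close> contribute equally, whence
    the factor 2.\<close>
  moreover have "hermitian_inner (N *v (V *v w)) w = - cnj (hermitian_inner (N *v w) (V *v w))"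
    using hermitian_inner_skew_hermitian[OF N, of "V *v w" w]
      hermitian_inner_commute[of "V *v w" "N *v w"] by simp
  ultimately show ?thesis
    by (simp add: inner_simps inner_outer hermitian_inner_simps)
qed


subsection \<open>Norming functionals\<close>

text \<open>Rescale \<open>Y\<close> to the unit sphere. Only the positive factor
  \<open>1 / nrm Y\<close> occurs, as the norm is only positively homogeneous.\<close>

lemma norming_functional_le:
  assumes F: "Ad_invariant_Finsler_norm nrm" and \<phi>: "norming_functional nrm \<phi> V"
    and Y: "Y \<in> skew_hermitian"
  shows "\<phi> Y \<le> nrm Y"
proof (cases "Y = 0")
  case True
  have "\<phi> (0 *\<^sub>R Y) = 0 * \<phi> Y"
    using \<phi> Y unfolding norming_functional_def linear_functional_def by blast
  moreover have "nrm Y = 0" using F Y True by (auto simp: Ad_invariant_Finsler_norm_def)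
  ultimately show ?thesis using True by simp
next
  case False
  then have pos: "nrm Y > 0"
    using F Y unfolding Ad_invariant_Finsler_norm_def by (metis less_eq_real_def)
  define Z where "Z = (1 / nrm Y) *\<^sub>R Y"
  have "nrm Z = 1"
    using F Y pos by (auto simp: Z_def Ad_invariant_Finsler_norm_def)
  moreover have "\<phi> Z = (1 / nrm Y) * \<phi> Y"
    unfolding Z_def using \<phi> Y unfolding norming_functional_def linear_functional_def by blast
  ultimately have "(1 / nrm Y) * \<phi> Y \<le> 1"
    using \<phi> Y skew_hermitian_closed(3)[OF Y, of "1 / nrm Y"]
    by (metis Z_def has_functional_norm_def norming_functional_def order_refl)
  then show ?thesis using pos by (simp add: field_simps)
qed

lemma norming_functional_orbit_le:
  assumes F: "Ad_invariant_Finsler_norm nrm" and V: "V \<in> skew_hermitian"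
    and N: "norming_functional nrm (trace_inner N) V" and U: "unitary U"
  shows "N \<bullet> (U ** V ** conj_transpose U) \<le> N \<bullet> V"
proof -
  have "trace_inner N (U ** V ** conj_transpose U) \<le> nrm (U ** V ** conj_transpose U)"
    using norming_functional_le[OF F N] skew_hermitian_conjugation[OF V] by blast
  also have "\<dots> = trace_inner N V"
    using F V U N by (simp add: Ad_invariant_Finsler_norm_def norming_functional_def)
  finally show ?thesis by (simp add: trace_inner_eq_inner)
qed

text \<open>Maximality at \<open>V\<close> reads \<open>c^2 Y <= 2 c X\<close>; cancelling
  \<open>c > 0\<close> and inserting \<open>c = 2 / |w|^2\<close> leaves an inequality homogeneous
  of degree 4 in \<open>w\<close>.\<close>

lemma norming_functional_householder:
  assumes F: "Ad_invariant_Finsler_norm nrm" and V: "V \<in> skew_hermitian"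
    and N: "N \<in> skew_hermitian" "norming_functional nrm (trace_inner N) V"
  shows "Re (cnj (hermitian_inner (V *v w) w) * hermitian_inner (N *v w) w)
    \<le> (norm w)\<^sup>2 * Re (hermitian_inner (N *v w) (V *v w))"
proof (cases "w = 0")
  case True
  then show ?thesis by (simp add: hermitian_inner_simps)
next
  case False
  define c where "c = 2 / (norm w)\<^sup>2"
  define X where "X = Re (hermitian_inner (N *v w) (V *v w))"
  define Y where "Y = Re (cnj (hermitian_inner (V *v w) w) * hermitian_inner (N *v w) w)"
  have c: "c > 0" using False by (simp add: c_def)
  have "- 2 * c * X + c\<^sup>2 * Y \<le> 0"
    using norming_functional_orbit_le[OF F V N(2) unitary_householder[OF False]]
    unfolding inner_householder_conjugation[OF N(1) V] c_def[symmetric] X_def[symmetric]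
      Y_def[symmetric]
    by simp
  then have "c * (c * Y) \<le> c * (2 * X)"
    by (simp add: power2_eq_square algebra_simps)
  then have "c * Y \<le> 2 * X" using c by simp
  then have "Y \<le> (norm w)\<^sup>2 * X"
    using False by (simp add: c_def field_simps)
  then show ?thesis by (simp add: X_def Y_def)
qed

section \<open>Block structure of \<open>N\<close> and ordering of its eigenvalues\<close>

text \<open>The reflection inequality at \<open>w = e + g\<close>. With \<open>p\<close>,
  \<open>q\<close> the imaginary parts of \<open><N w, e>\<close>, \<open><N w, g>\<close>, it
  collapses to \<open>(a - b) |e|^2 q <= (a - b) |g|^2 p\<close>, and \<open>a - b > 0\<close>
  cancels.\<close>

lemma norming_functional_eigenvectors:
  assumes F: "Ad_invariant_Finsler_norm nrm" and V: "V \<in> skew_hermitian"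
    and N: "N \<in> skew_hermitian" "norming_functional nrm (trace_inner N) V"
    and e: "V *v e = (\<i> * complex_of_real a) *s e" and g: "V *v g = (\<i> * complex_of_real b) *s g"
    and ab: "b < a"
  shows "(norm e)\<^sup>2 * Im (hermitian_inner (N *v (e + g)) g)
    \<le> (norm g)\<^sup>2 * Im (hermitian_inner (N *v (e + g)) e)"
proof -
  define w where "w = e + g"
  define p where "p = Im (hermitian_inner (N *v w) e)"
  define q where "q = Im (hermitian_inner (N *v w) g)"
  have eg: "hermitian_inner e g = 0"
    using skew_hermitian_eigenvectors_orthogonal[OF V e g] ab by simp
  then have ge: "hermitian_inner g e = 0"
    using hermitian_inner_commute[of g e] by simp
  have Vw: "V *v w = (\<i> * complex_of_real a) *s e + (\<i> * complex_of_real b) *s g"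
    by (simp add: w_def matrix_vector_right_distrib e g)
  have "complex_of_real ((norm w)\<^sup>2) = complex_of_real ((norm e)\<^sup>2 + (norm g)\<^sup>2)"
    unfolding of_real_add hermitian_inner_self[symmetric]
    by (simp add: w_def hermitian_inner_simps eg ge)
  then have nw: "(norm w)\<^sup>2 = (norm e)\<^sup>2 + (norm g)\<^sup>2"
    using of_real_eq_iff by blast
  have "hermitian_inner (V *v w) w = \<i> * complex_of_real (a * (norm e)\<^sup>2 + b * (norm g)\<^sup>2)"
    unfolding Vw by (simp add: w_def hermitian_inner_simps eg ge hermitian_inner_self algebra_simps)
  moreover have "Im (hermitian_inner (N *v w) w) = p + q"
    unfolding p_def q_def by (subst (2) w_def) (simp add: hermitian_inner_simps)
  ultimately have "Re (cnj (hermitian_inner (V *v w) w) * hermitian_inner (N *v w) w)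
      = (a * (norm e)\<^sup>2 + b * (norm g)\<^sup>2) * (p + q)"
    by simp
  moreover have "Re (hermitian_inner (N *v w) (V *v w)) = a * p + b * q"
    unfolding Vw by (simp add: hermitian_inner_simps p_def q_def)
  ultimately have "(a * (norm e)\<^sup>2 + b * (norm g)\<^sup>2) * (p + q)
      \<le> ((norm e)\<^sup>2 + (norm g)\<^sup>2) * (a * p + b * q)"
    using norming_functional_householder[OF F V N, of w] nw by simp
  then have "(a - b) * ((norm e)\<^sup>2 * q) \<le> (a - b) * ((norm g)\<^sup>2 * p)"
    by (simp add: algebra_simps)
  then show ?thesis using ab by (simp add: p_def q_def w_def)
qed

text \<open>Perturb \<open>e\<close> by a multiple of \<open>f\<close> of size proportional to
  \<open>t\<close>. A nonzero entry \<open>z\<close> contributes to the left side at first order in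
  \<open>t\<close>, whereas the right side is of second order because of
  \<open>|g|^2\<close>.\<close>

lemma norming_functional_offdiagonal_less:
  assumes F: "Ad_invariant_Finsler_norm nrm" and V: "V \<in> skew_hermitian"
    and N: "N \<in> skew_hermitian" "norming_functional nrm (trace_inner N) V"
    and e: "V *v e = (\<i> * complex_of_real a) *s e" and f: "V *v f = (\<i> * complex_of_real b) *s f"
    and ab: "b < a"
  shows "hermitian_inner (N *v e) f = 0"
proof (rule ccontr)
  define z where "z = hermitian_inner (N *v e) f"
  assume "hermitian_inner (N *v e) f \<noteq> 0"
  then have Z: "(norm z)\<^sup>2 > 0" by (simp add: z_def)
  then have e0: "(norm e)\<^sup>2 > 0" by (auto simp: z_def hermitian_inner_simps)
  define A where "A = Im (hermitian_inner (N *v e) e)"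
  define B where "B = Im (hermitian_inner (N *v f) f)"
  have Nfe: "hermitian_inner (N *v f) e = - cnj z"
    using hermitian_inner_skew_hermitian[OF N(1), of f e] hermitian_inner_commute[of f "N *v e"]
    by (simp add: z_def)
  have bound: "(norm e)\<^sup>2 * (1 + t * B) \<le> t * (norm f)\<^sup>2 * (A + t * (norm z)\<^sup>2)"
    if t: "t > 0" for t :: real
  proof -
    \<comment> \<open>The phase is chosen so that the cross term \<open>cnj \<beta> * z\<close>
      equals \<open>i t |z|^2\<close>, with positive imaginary part.\<close>
    define \<beta> where "\<beta> = - \<i> * complex_of_real t * z"
    have \<beta>\<beta>: "\<beta> * cnj \<beta> = complex_of_real (t\<^sup>2 * (norm z)\<^sup>2)"
      using complex_norm_square[of z] by (simp add: \<beta>_def power2_eq_square algebra_simps)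
    have zb: "cnj \<beta> * z = \<i> * complex_of_real (t * (norm z)\<^sup>2)"
      using complex_norm_square[of z] by (simp add: \<beta>_def)
    have zb': "\<beta> * cnj z = - \<i> * complex_of_real (t * (norm z)\<^sup>2)"
      using complex_norm_square[of z] by (simp add: \<beta>_def)
    define g where "g = \<beta> *s f"
    have "V *v g = (\<i> * complex_of_real b) *s g"
      by (simp add: g_def vector_scalar_commute f vector_smult_assoc mult.commute)
    from norming_functional_eigenvectors[OF F V N e this ab]
    have "(norm e)\<^sup>2 * Im (hermitian_inner (N *v (e + g)) g)
      \<le> (norm g)\<^sup>2 * Im (hermitian_inner (N *v (e + g)) e)" .
    moreover have "hermitian_inner (N *v (e + g)) g
        = cnj \<beta> * z + (\<beta> * cnj \<beta>) * hermitian_inner (N *v f) f"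
      by (simp add: g_def matrix_vector_right_distrib vector_scalar_commute hermitian_inner_simps
          z_def algebra_simps)
    then have "Im (hermitian_inner (N *v (e + g)) g) = t * (norm z)\<^sup>2 + t\<^sup>2 * (norm z)\<^sup>2 * B"
      unfolding zb \<beta>\<beta> by (simp add: B_def del: of_real_mult of_real_power)
    moreover have "hermitian_inner (N *v (e + g)) e = hermitian_inner (N *v e) e - \<beta> * cnj z"
      by (simp add: g_def matrix_vector_right_distrib vector_scalar_commute hermitian_inner_simps
          Nfe)
    then have "Im (hermitian_inner (N *v (e + g)) e) = A + t * (norm z)\<^sup>2"
      unfolding zb' by (simp add: A_def del: of_real_mult of_real_power)
    moreover have "complex_of_real ((norm g)\<^sup>2) = (\<beta> * cnj \<beta>) * complex_of_real ((norm f)\<^sup>2)"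
      unfolding hermitian_inner_self[symmetric] by (simp add: g_def hermitian_inner_simps)
    then have "(norm g)\<^sup>2 = t\<^sup>2 * (norm z)\<^sup>2 * (norm f)\<^sup>2"
      unfolding \<beta>\<beta> of_real_mult[symmetric] using of_real_eq_iff by blast
    ultimately have "(t * (norm z)\<^sup>2) * ((norm e)\<^sup>2 * (1 + t * B))
      \<le> (t * (norm z)\<^sup>2) * (t * (norm f)\<^sup>2 * (A + t * (norm z)\<^sup>2))"
      by (simp add: algebra_simps power2_eq_square)
    then show ?thesis
      using t Z by (simp add: mult_le_cancel_left_pos del: mult_le_cancel_left1)
  qed
  \<comment> \<open>After division by \<open>t |z|^2\<close>, letting \<open>t\<close> tend to 0
    from the right leaves \<open>|e|^2 <= 0\<close>.\<close>
  have "((\<lambda>t. (norm e)\<^sup>2 * (1 + t * B)) \<longlongrightarrow> (norm e)\<^sup>2 * (1 + 0 * B)) (at_right 0)"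
    and "((\<lambda>t. t * (norm f)\<^sup>2 * (A + t * (norm z)\<^sup>2)) \<longlongrightarrow> 0 * (norm f)\<^sup>2 * (A + 0 * (norm z)\<^sup>2))
      (at_right 0)"
    by (intro tendsto_intros)+
  then have "(norm e)\<^sup>2 * (1 + 0 * B) \<le> 0 * (norm f)\<^sup>2 * (A + 0 * (norm z)\<^sup>2)"
    using bound
    by (intro tendsto_le[of "at_right (0::real)"]) (auto simp: eventually_at_right_less eventually_at_filter)
  then show False using e0 by simp
qed

text \<open>For \<open>a < b\<close> exchange the two vectors, using
  \<open><N e, f> = - cnj <N f, e>\<close>.\<close>

lemma norming_functional_offdiagonal:
  assumes F: "Ad_invariant_Finsler_norm nrm" and V: "V \<in> skew_hermitian"
    and N: "N \<in> skew_hermitian" "norming_functional nrm (trace_inner N) V"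
    and e: "V *v e = (\<i> * complex_of_real a) *s e" and f: "V *v f = (\<i> * complex_of_real b) *s f"
    and ab: "a \<noteq> b"
  shows "hermitian_inner (N *v e) f = 0"
proof (cases "b < a")
  case True
  then show ?thesis using norming_functional_offdiagonal_less[OF F V N e f] by blast
next
  case False
  then have "hermitian_inner (N *v f) e = 0"
    using norming_functional_offdiagonal_less[OF F V N f e] ab by simp
  then show ?thesis
    using hermitian_inner_skew_hermitian[OF N(1), of e f] hermitian_inner_commute[of e "N *v f"]
    by simp
qed

text \<open>For joint eigenvectors the inequality at \<open>e + f\<close> has no cross terms and
  becomes \<open>|e|^2 |f|^2 d <= |e|^2 |f|^2 c\<close>. This is the core of item 1.\<close>

lemma norming_functional_eigenvalue_mono:
  assumes F: "Ad_invariant_Finsler_norm nrm" and V: "V \<in> skew_hermitian"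
    and N: "N \<in> skew_hermitian" "norming_functional nrm (trace_inner N) V"
    and e: "V *v e = (\<i> * complex_of_real a) *s e" "N *v e = (\<i> * complex_of_real c) *s e" "e \<noteq> 0"
    and f: "V *v f = (\<i> * complex_of_real b) *s f" "N *v f = (\<i> * complex_of_real d) *s f" "f \<noteq> 0"
    and ab: "b < a"
  shows "d \<le> c"
proof -
  have ef: "hermitian_inner e f = 0"
    using skew_hermitian_eigenvectors_orthogonal[OF V e(1) f(1)] ab by simp
  then have fe: "hermitian_inner f e = 0"
    using hermitian_inner_commute[of f e] by simp
  have "Im (hermitian_inner (N *v (e + f)) f) = d * (norm f)\<^sup>2"
    and "Im (hermitian_inner (N *v (e + f)) e) = c * (norm e)\<^sup>2"
    by (simp_all add: matrix_vector_right_distrib e(2) f(2) hermitian_inner_simps ef fe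
        hermitian_inner_self del: of_real_power)
  then have "((norm e)\<^sup>2 * (norm f)\<^sup>2) * d \<le> ((norm e)\<^sup>2 * (norm f)\<^sup>2) * c"
    using norming_functional_eigenvectors[OF F V N e(1) f(1) ab] by (simp add: mult_ac)
  moreover have "(norm e)\<^sup>2 * (norm f)\<^sup>2 > 0" using e(3) f(3) by simp
  ultimately show ?thesis by (simp only: mult_le_cancel_left_pos)
qed

section \<open>Unitary symmetry, smoothness and strict convexity\<close>

text \<open>The new functional is the old one composed with conjugation by the adjoint of
  \<open>U\<close>, an isometry of \<open>skew_hermitian\<close> onto itself that fixes
  \<open>V\<close>.\<close>

lemma norming_functional_conjugation:
  assumes F: "Ad_invariant_Finsler_norm nrm" and N: "N \<in> skew_hermitian"
    and \<phi>: "norming_functional nrm (trace_inner N) V" and V: "V \<in> skew_hermitian"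
    and U: "unitary U" "U ** V ** conj_transpose U = V"
  shows "norming_functional nrm (trace_inner (U ** N ** conj_transpose U)) V"
proof -
  have inv: "nrm (U ** Y ** conj_transpose U) = nrm Y"
    "nrm (conj_transpose U ** Y ** U) = nrm Y" if "Y \<in> skew_hermitian" for Y
    using F that U(1) unitary_conj_transpose[OF U(1)] conj_transpose_simps(1)[of U]
    unfolding Ad_invariant_Finsler_norm_def by metis+
  have skew: "conj_transpose U ** Y ** U \<in> skew_hermitian" if "Y \<in> skew_hermitian" for Y
    using skew_hermitian_conjugation[OF that, of "conj_transpose U"] by simp
  have cancel: "conj_transpose U ** (U ** Y ** conj_transpose U) ** U = Y" for Y
  proof -
    have "conj_transpose U ** (U ** Y ** conj_transpose U) ** U
        = (conj_transpose U ** U) ** Y ** (conj_transpose U ** U)"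
      by (simp add: matrix_mul_assoc)
    then show ?thesis using U(1) by (simp add: unitary_def)
  qed
  have "linear_functional (trace_inner (U ** N ** conj_transpose U))"
    by (simp add: linear_functional_def trace_inner_eq_inner inner_simps)
  moreover have "has_functional_norm nrm (trace_inner (U ** N ** conj_transpose U)) 1"
  proof -
    \<comment> \<open>The maximum 1 is attained at the conjugate by \<open>U\<close> of a maximiser
      for \<open>N\<close>.\<close>
    obtain Y where Y: "Y \<in> skew_hermitian" "nrm Y \<le> 1" "trace_inner N Y = 1"
      using \<phi> by (auto simp: norming_functional_def has_functional_norm_def)
    then have "trace_inner (U ** N ** conj_transpose U) (U ** Y ** conj_transpose U) = 1"
      by (simp add: trace_inner_conjugation cancel)
    moreover have "U ** Y ** conj_transpose U \<in> skew_hermitian"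
      using Y skew_hermitian_conjugation by blast
    ultimately have "\<exists>Y\<in>skew_hermitian. nrm Y \<le> 1
        \<and> trace_inner (U ** N ** conj_transpose U) Y = 1"
      using Y inv by metis
    moreover have "trace_inner (U ** N ** conj_transpose U) Y \<le> 1"
      if "Y \<in> skew_hermitian" "nrm Y \<le> 1" for Y
      using \<phi> skew[OF that(1)] inv(2)[OF that(1)] that(2)
      by (simp add: trace_inner_conjugation norming_functional_def has_functional_norm_def)
    ultimately show ?thesis by (simp add: has_functional_norm_def)
  qed
  moreover have "trace_inner (U ** N ** conj_transpose U) V = nrm V"
    using cancel[of V] \<phi> by (simp add: trace_inner_conjugation U(2) norming_functional_def)
  ultimately show ?thesis by (simp add: norming_functional_def)
qed

text \<open>For a norming \<theta>, the function \<open>nrm (V + t Y) - t \<theta>(Y)\<close> is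
  minimal at \<open>t = 0\<close>, so its derivative \<open>D Y - \<theta>(Y)\<close> vanishes
  there. Thus every norming functional agrees with \<open>D\<close>.\<close>

lemma smooth_norm_norming_functional_unique:
  assumes F: "Ad_invariant_Finsler_norm nrm" and smooth: "smooth_norm nrm"
    and V: "V \<in> skew_hermitian" "V \<noteq> 0"
    and \<phi>: "norming_functional nrm \<phi> V" and \<psi>: "norming_functional nrm \<psi> V"
    and Y: "Y \<in> skew_hermitian"
  shows "\<psi> Y = \<phi> Y"
proof -
  obtain D where D: "((\<lambda>t. nrm (V + t *\<^sub>R Y)) has_real_derivative D Y) (at 0)"
    using smooth V Y unfolding smooth_norm_def by blast
  have "D Y = \<theta> Y" if \<theta>: "norming_functional nrm \<theta> V" for \<theta>
  proof -
    have "((\<lambda>t. nrm (V + t *\<^sub>R Y) - t * \<theta> Y) has_real_derivative D Y - 1 * \<theta> Y) (at 0)"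
      by (intro DERIV_diff D DERIV_cmult_right DERIV_ident)
    moreover have "nrm (V + 0 *\<^sub>R Y) - 0 * \<theta> Y \<le> nrm (V + t *\<^sub>R Y) - t * \<theta> Y" for t
    proof -
      have "\<theta> (V + t *\<^sub>R Y) = \<theta> V + \<theta> (t *\<^sub>R Y)" "\<theta> (t *\<^sub>R Y) = t * \<theta> Y"
        using \<theta> V Y skew_hermitian_closed(3)[OF Y, of t]
        unfolding norming_functional_def linear_functional_def by blast+
      moreover have "\<theta> (V + t *\<^sub>R Y) \<le> nrm (V + t *\<^sub>R Y)"
        using norming_functional_le[OF F \<theta>] V Y by simp
      ultimately show ?thesis using \<theta> by (simp add: norming_functional_def)
    qed
    \<comment> \<open>The minimum is global, so the radius 1 is an arbitrary choice.\<close>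
    ultimately have "D Y - 1 * \<theta> Y = 0"
      by (intro DERIV_local_min[OF _ zero_less_one]) auto
    then show ?thesis by simp
  qed
  then show ?thesis using \<phi> \<psi> by metis
qed

text \<open>The midpoint of \<open>V\<close> and another point \<open>Y\<close> of the face has norm
  \<open>r\<close>: at least \<open>r\<close> by the functional, at most \<open>r\<close> by the
  triangle inequality. Scaled by \<open>1 / r\<close>, it is a unit vector inside a segment of the
  unit ball, hence not extreme.\<close>

lemma strictly_convex_norm_face:
  assumes F: "Ad_invariant_Finsler_norm nrm" and conv: "strictly_convex_norm nrm"
    and V: "V \<in> skew_hermitian" "V \<noteq> 0" and \<phi>: "norming_functional nrm \<phi> V"
  shows "face nrm \<phi> V = {V}"
proof -
  define r where "r = nrm V"
  have r: "r > 0"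
    using F V unfolding r_def Ad_invariant_Finsler_norm_def by (metis less_eq_real_def)
  have "Y = V" if "Y \<in> face nrm \<phi> V" for Y
  proof (rule ccontr)
    assume neq: "Y \<noteq> V"
    have Y: "Y \<in> skew_hermitian" "nrm Y \<le> r" "\<phi> Y = r"
      using that by (auto simp: face_def r_def)
    define M where "M = (1/2) *\<^sub>R Y + (1/2) *\<^sub>R V"
    have half: "(1/2) *\<^sub>R Y \<in> skew_hermitian" "(1/2) *\<^sub>R V \<in> skew_hermitian"
      using Y V by simp_all
    have M: "M \<in> skew_hermitian" using half by (simp add: M_def)
    have "\<phi> M = \<phi> ((1/2) *\<^sub>R Y) + \<phi> ((1/2) *\<^sub>R V)"
      "\<phi> ((1/2) *\<^sub>R Y) = (1/2) * \<phi> Y" "\<phi> ((1/2) *\<^sub>R V) = (1/2) * \<phi> V"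
      using \<phi> half Y(1) V(1) unfolding M_def norming_functional_def linear_functional_def by blast+
    then have "\<phi> M = r" using Y \<phi> by (simp add: norming_functional_def r_def)
    then have lower: "r \<le> nrm M" using norming_functional_le[OF F \<phi> M] by simp
    have scale: "nrm (l *\<^sub>R X) = l * nrm X" if "X \<in> skew_hermitian" "0 \<le> l" for l X
      using F that by (simp add: Ad_invariant_Finsler_norm_def)
    have "nrm M \<le> nrm ((1/2) *\<^sub>R Y) + nrm ((1/2) *\<^sub>R V)"
      using F half unfolding M_def Ad_invariant_Finsler_norm_def by blast
    also have "\<dots> \<le> r" using Y V scale by (simp add: r_def)
    finally have "nrm M = r" using lower by simp
    then have "nrm ((1/r) *\<^sub>R M) = 1" using scale[OF M] r by simp
    then have ext: "((1/r) *\<^sub>R M) extreme_point_of {Y\<in>skew_hermitian. nrm Y \<le> 1}"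
      using conv M by (simp add: strictly_convex_norm_def)
    have "(1/r) *\<^sub>R Y \<in> {Y\<in>skew_hermitian. nrm Y \<le> 1}"
      "(1/r) *\<^sub>R V \<in> {Y\<in>skew_hermitian. nrm Y \<le> 1}"
      using Y V r scale by (simp_all add: r_def)
    moreover have "(1/r) *\<^sub>R M \<in> open_segment ((1/r) *\<^sub>R Y) ((1/r) *\<^sub>R V)"
    proof -
      have "(1/r) *\<^sub>R M = (1 - 1/2) *\<^sub>R ((1/r) *\<^sub>R Y) + (1/2) *\<^sub>R ((1/r) *\<^sub>R V)"
        by (simp add: M_def scaleR_add_right mult.commute)
      moreover have "(1/r) *\<^sub>R Y \<noteq> (1/r) *\<^sub>R V" using neq r by simp
      ultimately show ?thesis
        unfolding in_segment by (intro conjI exI[of _ "1/2"]) simp_all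
    qed
    ultimately show False using ext unfolding extreme_point_of_def by blast
  qed
  moreover have "V \<in> face nrm \<phi> V" using V \<phi> by (simp add: face_def norming_functional_def)
  ultimately show ?thesis by blast
qed


subsection \<open>Spectral decompositions\<close>

text \<open>Spectral data are stated for \<open>- i A\<close>, while the reflection estimates use
  the skew-Hermitian \<open>A\<close> itself.\<close>

lemma i_cmat_scale_iff: "A *v x = (\<i> * c) *s x \<longleftrightarrow> ((- \<i>) *\<^sub>M A) *v x = c *s x"
proof
  assume "A *v x = (\<i> * c) *s x"
  then show "((- \<i>) *\<^sub>M A) *v x = c *s x"
    by (simp add: cmat_scale_vector vector_smult_assoc)
next
  assume "((- \<i>) *\<^sub>M A) *v x = c *s x"
  then have "\<i> *s ((- \<i>) *s (A *v x)) = \<i> *s (c *s x)"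
    by (simp add: cmat_scale_vector)
  then show "A *v x = (\<i> * c) *s x"
    by (simp add: vector_smult_assoc)
qed

lemma spectral_decomposition_Ran_iff:
  assumes "spectral_decomposition V m v P" and "k \<in> {1..m}"
  shows "x \<in> Ran (P k) \<longleftrightarrow> V *v x = (\<i> * complex_of_real (v k)) *s x"
  using assms
  by (auto simp: spectral_decomposition_def orthogonal_projection_onto_def i_cmat_scale_iff)

lemma spectral_decomposition_projection:
  assumes "spectral_decomposition V m v P" and "k \<in> {1..m}"
  shows "P k ** P k = P k" and "conj_transpose (P k) = P k"
  using assms by (auto simp: spectral_decomposition_def orthogonal_projection_onto_def)

lemma spectral_decomposition_Ran_fixed:
  assumes "spectral_decomposition V m v P" and "k \<in> {1..m}"
  shows "x \<in> Ran (P k) \<longleftrightarrow> P k *v x = x"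
proof
  assume "x \<in> Ran (P k)"
  then obtain y where "x = P k *v y" by (auto simp: Ran_def)
  then show "P k *v x = x"
    using spectral_decomposition_projection(1)[OF assms] by (simp add: matrix_vector_mul_assoc)
next
  assume "P k *v x = x"
  then show "x \<in> Ran (P k)" unfolding Ran_def by (metis rangeI)
qed

lemma spectral_decomposition_strict_antimono:
  assumes "spectral_decomposition V m v P" and "k \<in> {1..m}" and "j \<in> {1..m}" and "k < j"
  shows "v j < v k"
  using assms unfolding spectral_decomposition_def by blast

lemma spectral_decomposition_distinct:
  assumes "spectral_decomposition V m v P" and "k \<in> {1..m}" and "j \<in> {1..m}" and "k \<noteq> j"
  shows "v k \<noteq> v j"
  using spectral_decomposition_strict_antimono[OF assms(1,2,3)]
    spectral_decomposition_strict_antimono[OF assms(1,3,2)] assms(4)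
  by (cases k j rule: linorder_cases) auto

lemma spectral_decomposition_Ran_nontrivial:
  assumes "spectral_decomposition V m v P" and "k \<in> {1..m}"
  obtains x where "x \<in> Ran (P k)" and "x \<noteq> 0"
proof -
  have "eigenvalue_on UNIV ((- \<i>) *\<^sub>M V) (complex_of_real (v k))"
    using assms unfolding spectral_decomposition_def by blast
  then show ?thesis
    using that spectral_decomposition_Ran_iff[OF assms]
    by (auto simp: eigenvalue_on_def eigenvector_on_def i_cmat_scale_iff)
qed

lemma spectral_decomposition_orthogonal:
  assumes V: "V \<in> skew_hermitian" and S: "spectral_decomposition V m v P"
    and k: "k \<in> {1..m}" and j: "j \<in> {1..m}" and "k \<noteq> j" and x: "x \<in> Ran (P k)"
  shows "P j *v x = 0"
proof (rule hermitian_inner_ext)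
  fix y
  have "P j *v y \<in> Ran (P j)" by (simp add: Ran_def)
  then have "hermitian_inner x (P j *v y) = 0"
    using skew_hermitian_eigenvectors_orthogonal[OF V _ _ spectral_decomposition_distinct[OF S k j]]
      spectral_decomposition_Ran_iff[OF S k] spectral_decomposition_Ran_iff[OF S j] x \<open>k \<noteq> j\<close>
    by blast
  then show "hermitian_inner (P j *v x) y = hermitian_inner 0 y"
    by (simp add: hermitian_inner_conj_transpose spectral_decomposition_projection(2)[OF S j]
        hermitian_inner_simps)
qed

text \<open>Completeness needs no spectral theorem: a vector killed by all \<open>P k\<close> is killed by \<open>V\<close>, so
  were it nonzero it would lie in the eigenspace of one of the \<open>v k\<close>.\<close>

lemma spectral_decomposition_sum:
  assumes V: "V \<in> skew_hermitian" and S: "spectral_decomposition V m v P"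
  shows "(\<Sum>k=1..m. P k *v x) = x"
proof -
  define y where "y = x - (\<Sum>k=1..m. P k *v x)"
  have Py: "P j *v y = 0" if j: "j \<in> {1..m}" for j
  proof -
    have "P j *v (\<Sum>k=1..m. P k *v x) = (\<Sum>k=1..m. P j *v (P k *v x))"
      by (rule matrix_vector_mult_sum)
    also have "\<dots> = (\<Sum>k=1..m. if k = j then P j *v x else 0)"
    proof (rule sum.cong)
      fix k assume k: "k \<in> {1..m}"
      have "P k *v x \<in> Ran (P k)" by (simp add: Ran_def)
      then show "P j *v (P k *v x) = (if k = j then P j *v x else 0)"
        using spectral_decomposition_orthogonal[OF V S k j]
          spectral_decomposition_Ran_fixed[OF S j] by auto
    qed simp
    finally show ?thesis using j by (simp add: y_def matrix_vector_mult_diff_distrib)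
  qed
  have "V = \<i> *\<^sub>M (\<Sum>k=1..m. v k *\<^sub>R P k)"
    using S by (simp add: spectral_decomposition_def)
  then have "V *v y = \<i> *s (\<Sum>k=1..m. complex_of_real (v k) *s (P k *v y))"
    by (simp add: cmat_scale_vector sum_matrix_vector_mult scaleR_matrix_vector)
  also have "\<dots> = 0" using Py by simp
  finally have Vy: "V *v y = (\<i> * 0) *s y" by simp
  have "y = 0"
  proof (rule ccontr)
    assume "y \<noteq> 0"
    then have "eigenvalue_on UNIV ((- \<i>) *\<^sub>M V) 0"
      using Vy i_cmat_scale_iff[of V y 0]
      unfolding eigenvalue_on_def eigenvector_on_def by blast
    then have "(0::complex) \<in> (\<lambda>k. complex_of_real (v k)) ` {1..m}"
      using S unfolding spectral_decomposition_def by blast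
    then obtain k where k: "k \<in> {1..m}" "complex_of_real (v k) = 0" by auto
    then have "y \<in> Ran (P k)" using Vy spectral_decomposition_Ran_iff[OF S k(1)] by simp
    then show False
      using Py[OF k(1)] spectral_decomposition_Ran_fixed[OF S k(1)] \<open>y \<noteq> 0\<close> by simp
  qed
  then show ?thesis by (simp add: y_def)
qed

text \<open>Comparing the eigenvalues at \<open>x\<close>, \<open>x0\<close> and
  \<open>x + x0\<close> shows that either they all coincide or \<open>x\<close> is a multiple of
  \<open>x0\<close>.\<close>

lemma scalar_on_subspace:
  fixes A :: "complex^'n^'n"
  assumes add: "\<And>x y. x \<in> S \<Longrightarrow> y \<in> S \<Longrightarrow> x + y \<in> S"
    and eig: "\<And>x. x \<in> S \<Longrightarrow> x \<noteq> 0 \<Longrightarrow> \<exists>c. A *v x = c *s x"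
    and x0: "x0 \<in> S" "x0 \<noteq> 0" "A *v x0 = c *s x0" and x: "x \<in> S"
  shows "A *v x = c *s x"
\<comment> \<open>\<open>eig\<close> speaks of nonzero vectors only, so \<open>x\<close> and
  \<open>x + x0\<close> must both be nonzero before it is applied.\<close>
proof (cases "x = 0 \<or> x + x0 = 0")
  case True
  then have "x = 0 \<or> x = - x0" by (simp add: eq_neg_iff_add_eq_0)
  then show ?thesis using x0(3) by (auto simp: matrix_vector_mult_minus)
next
  case False
  then obtain a b where a: "A *v x = a *s x" and b: "A *v (x + x0) = b *s (x + x0)"
    using eig add x x0(1) by metis
  have eq: "(b - a) *s x = (c - b) *s x0"
    using b by (simp add: matrix_vector_right_distrib a x0(3) vec_eq_iff algebra_simps)
  show ?thesis
  proof (cases "b = a")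
    case True
    then show ?thesis using eq a x0(2) by simp
  next
    case False
    then have "x = (1 / (b - a) * (b - a)) *s x" by simp
    also have "\<dots> = (1 / (b - a)) *s ((b - a) *s x)" by (simp only: vector_smult_assoc)
    also have "\<dots> = ((c - b) / (b - a)) *s x0" by (simp only: eq vector_smult_assoc) simp
    finally have "x = ((c - b) / (b - a)) *s x0" .
    then show ?thesis
      by (metis x0(3) vector_scalar_commute vector_smult_assoc mult.commute)
  qed
qed

subsection \<open>Norming functionals and the spectral decomposition\<close>

text \<open>Vanishing off-diagonal entries give \<open>P j (N x) = 0\<close> for all
  \<open>j\<close> other than \<open>k\<close>, and completeness of the projections leaves
  \<open>N x = P k (N x)\<close>.\<close>

lemma norming_functional_Ran_invariant:
  assumes F: "Ad_invariant_Finsler_norm nrm" and V: "V \<in> skew_hermitian"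
    and S: "spectral_decomposition V m v P"
    and N: "N \<in> skew_hermitian" "norming_functional nrm (trace_inner N) V"
    and k: "k \<in> {1..m}" and x: "x \<in> Ran (P k)"
  shows "N *v x \<in> Ran (P k)"
proof -
  have "P j *v (N *v x) = 0" if j: "j \<in> {1..m}" "j \<noteq> k" for j
  proof (rule hermitian_inner_ext)
    fix y
    have "P j *v y \<in> Ran (P j)" by (simp add: Ran_def)
    then have "hermitian_inner (N *v x) (P j *v y) = 0"
      using norming_functional_offdiagonal[OF F V N _ _ spectral_decomposition_distinct[OF S k j(1)]]
        spectral_decomposition_Ran_iff[OF S k] spectral_decomposition_Ran_iff[OF S j(1)] x j(2)
      by blast
    then show "hermitian_inner (P j *v (N *v x)) y = hermitian_inner 0 y"
      by (simp add: hermitian_inner_conj_transpose spectral_decomposition_projection(2)[OF S j(1)]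
          hermitian_inner_simps)
  qed
  then have "(\<Sum>j=1..m. P j *v (N *v x)) = (\<Sum>j=1..m. if j = k then P k *v (N *v x) else 0)"
    by (intro sum.cong) auto
  then have "P k *v (N *v x) = N *v x"
    using k spectral_decomposition_sum[OF V S, of "N *v x"] by simp
  then show ?thesis using spectral_decomposition_Ran_fixed[OF S k] by simp
qed

lemma norming_functional_block_vector:
  assumes F: "Ad_invariant_Finsler_norm nrm" and V: "V \<in> skew_hermitian"
    and S: "spectral_decomposition V m v P"
    and N: "N \<in> skew_hermitian" "norming_functional nrm (trace_inner N) V"
    and k: "k \<in> {1..m}"
  shows "block N (P k) *v x = (- \<i>) *s (N *v (P k *v x))"
proof -
  have "P k *v x \<in> Ran (P k)" by (simp add: Ran_def)
  then have "P k *v (N *v (P k *v x)) = N *v (P k *v x)"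
    using norming_functional_Ran_invariant[OF F V S N k] spectral_decomposition_Ran_fixed[OF S k]
    by blast
  then show ?thesis
    by (simp add: block_def matrix_vector_mul_assoc[symmetric] cmat_scale_vector
        vector_scalar_commute matrix_vector_mult_minus)
qed

text \<open>Eigenvectors of a block are the joint eigenvectors of \<open>V\<close> and
  \<open>N\<close>; all items are proved in this form.\<close>

lemma norming_functional_block_eigenvector:
  assumes F: "Ad_invariant_Finsler_norm nrm" and V: "V \<in> skew_hermitian"
    and S: "spectral_decomposition V m v P"
    and N: "N \<in> skew_hermitian" "norming_functional nrm (trace_inner N) V"
    and k: "k \<in> {1..m}"
  shows "eigenvector_on (Ran (P k)) (block N (P k)) c x \<longleftrightarrow>
    x \<noteq> 0 \<and> V *v x = (\<i> * complex_of_real (v k)) *s x \<and> N *v x = (\<i> * c) *s x"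
  using norming_functional_block_vector[OF F V S N k, of x] spectral_decomposition_Ran_fixed[OF S k]
    spectral_decomposition_Ran_iff[OF S k, of x]
  by (auto simp: eigenvector_on_def i_cmat_scale_iff cmat_scale_vector)

lemma norming_functional_sum_blocks:
  assumes F: "Ad_invariant_Finsler_norm nrm" and V: "V \<in> skew_hermitian"
    and S: "spectral_decomposition V m v P"
    and N: "N \<in> skew_hermitian" "norming_functional nrm (trace_inner N) V"
  shows "N = \<i> *\<^sub>M (\<Sum>k=1..m. block N (P k))"
proof -
  have "(\<i> *\<^sub>M (\<Sum>k=1..m. block N (P k))) *v x = N *v x" for x
  proof -
    have "(\<Sum>k=1..m. block N (P k) *v x) = (\<Sum>k=1..m. ((- \<i>) *\<^sub>M N) *v (P k *v x))"
      by (intro sum.cong) (simp_all add: norming_functional_block_vector[OF F V S N]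
          cmat_scale_vector)
    also have "\<dots> = ((- \<i>) *\<^sub>M N) *v x"
      by (simp only: matrix_vector_mult_sum[symmetric] spectral_decomposition_sum[OF V S])
    finally show ?thesis
      by (simp add: cmat_scale_vector sum_matrix_vector_mult vector_smult_assoc)
  qed
  then show ?thesis by (simp add: matrix_eq)
qed

text \<open>A reflection in a vector \<open>x\<close> of an eigenspace of \<open>V\<close> fixes \<open>V\<close>, so by uniqueness it fixes
  \<open>N\<close>, which forces \<open>x\<close> to be an eigenvector of \<open>N\<close>.\<close>

lemma norming_functional_unique_eigenvector:
  assumes F: "Ad_invariant_Finsler_norm nrm" and V: "V \<in> skew_hermitian"
    and N: "N \<in> skew_hermitian" "norming_functional nrm (trace_inner N) V"
    and unique: "\<forall>\<psi>. norming_functional nrm \<psi> V \<longrightarrow>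
      (\<forall>Y\<in>skew_hermitian. \<psi> Y = trace_inner N Y)"
    and x: "V *v x = (\<i> * complex_of_real a) *s x" "x \<noteq> 0"
  shows "\<exists>c. N *v x = (\<i> * complex_of_real c) *s x"
proof -
  define U where "U = householder x"
  define M where "M = U ** N ** conj_transpose U"
  have U: "unitary U" by (simp add: U_def unitary_householder x)
  have "norming_functional nrm (trace_inner M) V"
    unfolding M_def
    by (intro norming_functional_conjugation[OF F N V U])
      (simp add: U_def householder_conjugation_eq[OF V x])
  \<comment> \<open>Uniqueness compares functionals on \<open>skew_hermitian\<close> only; testing
    it on \<open>M - N\<close> gives squared norm 0.\<close>
  moreover have "M - N \<in> skew_hermitian"
    unfolding M_def by (intro skew_hermitian_closed(2) skew_hermitian_conjugation N)
  ultimately have "M \<bullet> (M - N) = N \<bullet> (M - N)"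
    using unique by (simp add: trace_inner_eq_inner)
  then have "(M - N) \<bullet> (M - N) = 0" by (simp add: inner_diff_left)
  then have "M = N" by simp
  then have "U ** N = N ** U" using unitary_conjugation_eq_iff[OF U] by (simp add: M_def)
  then have "U *v (N *v x) = N *v (U *v x)" by (simp add: matrix_vector_mul_assoc)
  \<comment> \<open>Since \<open>U\<close> negates \<open>x\<close> and commutes with
    \<open>N\<close>, it also negates \<open>N x\<close>; solving the reflection formula for
    \<open>N x\<close> yields a multiple of \<open>x\<close>.\<close>
  moreover have "U *v x = - x"
    using x by (simp add: U_def householder_vector hermitian_inner_self vec_eq_iff)
  ultimately have "U *v (N *v x) = - (N *v x)"
    by (simp only: matrix_vector_mult_minus)
  then have "N *v x - (complex_of_real (2 / (norm x)\<^sup>2) * hermitian_inner (N *v x) x) *s x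
      = - (N *v x)"
    by (simp only: U_def householder_vector)
  moreover define k where "k = complex_of_real (1 / (norm x)\<^sup>2) * hermitian_inner (N *v x) x"
  ultimately have eq: "N *v x - (2 * k) *s x = - (N *v x)"
    by simp
  have "(N *v x) $ i = (k *s x) $ i" for i
  proof -
    have "(N *v x) $ i - 2 * k * x $ i = - (N *v x) $ i"
      using arg_cong[OF eq, of "\<lambda>y. y $ i"] by simp
    then have "2 * (N *v x) $ i = 2 * (k * x $ i)" by (simp add: algebra_simps)
    then show ?thesis by simp
  qed
  then have "N *v x = (complex_of_real (1 / (norm x)\<^sup>2) * hermitian_inner (N *v x) x) *s x"
    unfolding k_def[symmetric] vec_eq_iff by blast
  \<comment> \<open>Skew-Hermitian \<open>N\<close> makes this entry purely imaginary, so the factor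
    is \<open>i\<close> times a real number.\<close>
  moreover have "Re (hermitian_inner (N *v x) x) = 0"
    using hermitian_inner_skew_hermitian[OF N(1), of x x]
      hermitian_inner_commute[of x "N *v x"] by (simp add: complex_eq_iff)
  then have "hermitian_inner (N *v x) x = \<i> * complex_of_real (Im (hermitian_inner (N *v x) x))"
    by (simp add: complex_eq_iff)
  ultimately have "N *v x
      = (\<i> * complex_of_real (1 / (norm x)\<^sup>2 * Im (hermitian_inner (N *v x) x))) *s x"
    by (metis (no_types, opaque_lifting) mult.left_commute of_real_mult)
  then show ?thesis by blast
qed

text \<open>On each eigenspace of \<open>V\<close> every nonzero vector is an eigenvector of
  \<open>N\<close>, so \<open>N\<close> acts there as a scalar. The second conclusion lets the
  eigenvalue inequalities of items 1 and 3 apply to the \<open>n k\<close>.\<close>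

lemma norming_functional_unique_diagonal:
  assumes F: "Ad_invariant_Finsler_norm nrm" and V: "V \<in> skew_hermitian"
    and S: "spectral_decomposition V m v P"
    and N: "N \<in> skew_hermitian" "norming_functional nrm (trace_inner N) V"
    and unique: "\<forall>\<psi>. norming_functional nrm \<psi> V \<longrightarrow>
      (\<forall>Y\<in>skew_hermitian. \<psi> Y = trace_inner N Y)"
  obtains n :: "nat \<Rightarrow> real" where "N = \<i> *\<^sub>M (\<Sum>k=1..m. n k *\<^sub>R P k)"
    and "\<And>k. k \<in> {1..m} \<Longrightarrow>
      eigenvalue_on (Ran (P k)) (block N (P k)) (complex_of_real (n k))"
proof -
  note Ran = spectral_decomposition_Ran_iff[OF S]
  have "\<exists>c. (\<forall>x\<in>Ran (P k). N *v x = (\<i> * complex_of_real c) *s x)" if k: "k \<in> {1..m}" for k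
  proof -
    have eig: "\<exists>c. N *v x = (\<i> * complex_of_real c) *s x" if "x \<in> Ran (P k)" "x \<noteq> 0" for x
      using norming_functional_unique_eigenvector[OF F V N unique] Ran[OF k] that by blast
    obtain x0 where x0: "x0 \<in> Ran (P k)" "x0 \<noteq> 0"
      using spectral_decomposition_Ran_nontrivial[OF S k] .
    then obtain c where c: "N *v x0 = (\<i> * complex_of_real c) *s x0" using eig by blast
    have "N *v x = (\<i> * complex_of_real c) *s x" if "x \<in> Ran (P k)" for x
    proof (rule scalar_on_subspace[OF _ _ x0 c that])
      show "x + y \<in> Ran (P k)" if "x \<in> Ran (P k)" "y \<in> Ran (P k)" for x y
        using that by (simp add: Ran[OF k] matrix_vector_right_distrib vector_add_ldistrib)
    qed (use eig in blast)
    then show ?thesis by blast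
  qed
  then obtain n where n: "\<And>k x. k \<in> {1..m} \<Longrightarrow> x \<in> Ran (P k) \<Longrightarrow>
      N *v x = (\<i> * complex_of_real (n k)) *s x"
    by metis
  show ?thesis
  proof (rule that)
    have "(\<i> *\<^sub>M (\<Sum>k=1..m. n k *\<^sub>R P k)) *v x = N *v x" for x
    proof -
      have "complex_of_real (n k) *s (P k *v x) = ((- \<i>) *\<^sub>M N) *v (P k *v x)"
        if "k \<in> {1..m}" for k
        using n[OF that, of "P k *v x"] by (simp add: Ran_def i_cmat_scale_iff)
      then have "(\<Sum>k=1..m. complex_of_real (n k) *s (P k *v x))
          = (\<Sum>k=1..m. ((- \<i>) *\<^sub>M N) *v (P k *v x))"
        by (intro sum.cong) simp_all
      also have "\<dots> = ((- \<i>) *\<^sub>M N) *v x"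
        by (simp only: matrix_vector_mult_sum[symmetric] spectral_decomposition_sum[OF V S])
      finally show ?thesis
        by (simp add: cmat_scale_vector sum_matrix_vector_mult scaleR_matrix_vector
            vector_smult_assoc)
    qed
    then show "N = \<i> *\<^sub>M (\<Sum>k=1..m. n k *\<^sub>R P k)" by (simp add: matrix_eq)
  next
    fix k assume k: "k \<in> {1..m}"
    obtain x where x: "x \<in> Ran (P k)" "x \<noteq> 0"
      using spectral_decomposition_Ran_nontrivial[OF S k] .
    then show "eigenvalue_on (Ran (P k)) (block N (P k)) (complex_of_real (n k))"
      unfolding eigenvalue_on_def norming_functional_block_eigenvector[OF F V S N k]
      using n[OF k] Ran[OF k] by blast
  qed
qed

theorem proposition2p31:
  fixes nrm :: "complex^'n^'n \<Rightarrow> real"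
    and V N :: "complex^'n^'n"
    and m :: nat and v :: "nat \<Rightarrow> real" and P :: "nat \<Rightarrow> complex^'n^'n"
  assumes "Ad_invariant_Finsler_norm nrm"
    and "V \<in> skew_hermitian" and "V \<noteq> 0"
    and "spectral_decomposition V m v P"
    and "N \<in> skew_hermitian"
    and "norming_functional nrm (trace_inner N) V"
  shows "N = \<i> *\<^sub>M (\<Sum>k=1..m. block N (P k)) \<and>
   \<comment> \<open>item 1\<close>
   (\<forall>k\<in>{1..m}. \<forall>j\<in>{1..m}. \<forall>a b :: real. k < j \<longrightarrow>
      eigenvalue_on (Ran (P k)) (block N (P k)) (complex_of_real a) \<longrightarrow>
      eigenvalue_on (Ran (P j)) (block N (P j)) (complex_of_real b) \<longrightarrow> a \<ge> b) \<and>
   \<comment> \<open>item 2\<close>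
   (\<forall>k\<in>{1..m}. \<forall>j\<in>{1..m}. \<forall>a :: real. \<forall>e f U. k < j \<longrightarrow>
      eigenvector_on (Ran (P k)) (block N (P k)) (complex_of_real a) e \<longrightarrow> norm e = 1 \<longrightarrow>
      eigenvector_on (Ran (P j)) (block N (P j)) (complex_of_real a) f \<longrightarrow> norm f = 1 \<longrightarrow>
      exchanges U e f \<longrightarrow>
      U ** V ** conj_transpose U \<noteq> V \<and>
      U ** V ** conj_transpose U \<in> face nrm (trace_inner N) V) \<and>
   \<comment> \<open>item 3\<close>
   (face nrm (trace_inner N) V = {V} \<longrightarrow>
     (\<forall>k\<in>{1..m}. \<forall>j\<in>{1..m}. \<forall>a b :: real. k < j \<longrightarrow>
        eigenvalue_on (Ran (P k)) (block N (P k)) (complex_of_real a) \<longrightarrow>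
        eigenvalue_on (Ran (P j)) (block N (P j)) (complex_of_real b) \<longrightarrow> a > b)) \<and>
   \<comment> \<open>item 4\<close>
   (\<forall>s\<in>{1..m}. \<forall>a b :: real. \<forall>e f U. a \<noteq> b \<longrightarrow>
      eigenvector_on (Ran (P s)) (block N (P s)) (complex_of_real a) e \<longrightarrow> norm e = 1 \<longrightarrow>
      eigenvector_on (Ran (P s)) (block N (P s)) (complex_of_real b) f \<longrightarrow> norm f = 1 \<longrightarrow>
      exchanges U e f \<longrightarrow>
      (\<exists>Y\<in>skew_hermitian. trace_inner (U ** N ** conj_transpose U) Y \<noteq> trace_inner N Y) \<and>
      norming_functional nrm (trace_inner (U ** N ** conj_transpose U)) V) \<and>
   \<comment> \<open>item 5\<close>
   ((\<forall>\<psi>. norming_functional nrm \<psi> V \<longrightarrow> (\<forall>Y\<in>skew_hermitian. \<psi> Y = trace_inner N Y)) \<longrightarrow>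
     (\<exists>n :: nat \<Rightarrow> real. N = \<i> *\<^sub>M (\<Sum>k=1..m. n k *\<^sub>R P k) \<and>
        (\<forall>k\<in>{1..<m}. n k \<ge> n (k + 1)))) \<and>
   \<comment> \<open>the strictly convex and smooth case\<close>
   (strictly_convex_norm nrm \<and> smooth_norm nrm \<longrightarrow>
     (\<exists>n :: nat \<Rightarrow> real. N = \<i> *\<^sub>M (\<Sum>k=1..m. n k *\<^sub>R P k) \<and>
        (\<forall>k\<in>{1..<m}. n k > n (k + 1))))"

proof -
  note F = assms(1) and V = assms(2) and S = assms(4) and N = assms(5,6)
  note eigvec = norming_functional_block_eigenvector[OF F V S N]
  have sum: "N = \<i> *\<^sub>M (\<Sum>k=1..m. block N (P k))"
    by (rule norming_functional_sum_blocks[OF F V S N])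
  have item1: "b \<le> a"
    if kj: "k \<in> {1..m}" "j \<in> {1..m}" "k < j"
      and ev: "eigenvalue_on (Ran (P k)) (block N (P k)) (complex_of_real a)"
        "eigenvalue_on (Ran (P j)) (block N (P j)) (complex_of_real b)" for k j and a b :: real
  proof -
    obtain e f where "eigenvector_on (Ran (P k)) (block N (P k)) (complex_of_real a) e"
      "eigenvector_on (Ran (P j)) (block N (P j)) (complex_of_real b) f"
      using ev by (auto simp: eigenvalue_on_def)
    then show ?thesis
      using norming_functional_eigenvalue_mono[OF F V N _ _ _ _ _ _
          spectral_decomposition_strict_antimono[OF S kj]]
      unfolding eigvec[OF kj(1)] eigvec[OF kj(2)] by blast
  qed
  have orth: "hermitian_inner e f = 0"
    if "k \<in> {1..m}" "j \<in> {1..m}" "k < j"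
      "eigenvector_on (Ran (P k)) (block N (P k)) (complex_of_real a) e"
      "eigenvector_on (Ran (P j)) (block N (P j)) (complex_of_real b) f" for k j e f and a b :: real
    using skew_hermitian_eigenvectors_orthogonal[OF V]
      spectral_decomposition_strict_antimono[OF S that(1-3)] that(4,5)
    unfolding eigvec[OF that(1)] eigvec[OF that(2)] by (metis less_irrefl)
  have item2: "U ** V ** conj_transpose U \<noteq> V
      \<and> U ** V ** conj_transpose U \<in> face nrm (trace_inner N) V"
    if kj: "k \<in> {1..m}" "j \<in> {1..m}" "k < j"
      and e: "eigenvector_on (Ran (P k)) (block N (P k)) (complex_of_real a) e" "norm e = 1"
      and f: "eigenvector_on (Ran (P j)) (block N (P j)) (complex_of_real a) f" "norm f = 1"
      and U: "exchanges U e f" for k j e f U and a :: real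
  proof
    note e' = e(1)[unfolded eigvec[OF kj(1)]] and f' = f(1)[unfolded eigvec[OF kj(2)]]
    have un: "unitary U" using U by (simp add: exchanges_def)
    have "\<i> * complex_of_real (v k) \<noteq> \<i> * complex_of_real (v j)"
      using spectral_decomposition_strict_antimono[OF S kj] by simp
    then show "U ** V ** conj_transpose U \<noteq> V"
      using exchanges_conjugation_neq e' f' f(2) U by blast
    have "U ** N ** conj_transpose U = N"
      using exchanges_conjugation_eq[OF N(1)] e' f' e(2) f(2) orth[OF kj e(1) f(1)] U by blast
    \<comment> \<open>Conjugation of \<open>V\<close> by \<open>U\<close> moves to \<open>N\<close>
      as conjugation by the adjoint, so invariance of \<open>N\<close> is needed in that
      form.\<close>
    then have "conj_transpose U ** N ** U = conj_transpose U ** (U ** N ** conj_transpose U) ** U"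
      by simp
    also have "\<dots> = (conj_transpose U ** U) ** N ** (conj_transpose U ** U)"
      by (simp add: matrix_mul_assoc)
    finally have "conj_transpose U ** N ** U = N" using un by (simp add: unitary_def)
    then have "trace_inner N (U ** V ** conj_transpose U) = trace_inner N V"
      using trace_inner_conjugation[of U V N]
      by (simp add: trace_inner_eq_inner inner_commute)
    then show "U ** V ** conj_transpose U \<in> face nrm (trace_inner N) V"
      using F V N(2) un skew_hermitian_conjugation[OF V, of U]
      by (simp add: face_def norming_functional_def Ad_invariant_Finsler_norm_def)
  qed
  have item3: "b < a"
    if face: "face nrm (trace_inner N) V = {V}" and kj: "k \<in> {1..m}" "j \<in> {1..m}" "k < j"
      and a: "eigenvalue_on (Ran (P k)) (block N (P k)) (complex_of_real a)"
      and b: "eigenvalue_on (Ran (P j)) (block N (P j)) (complex_of_real b)" for k j and a b :: real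
  proof (rule ccontr)
    assume "\<not> b < a"
    then have [simp]: "b = a" using item1[OF kj a b] by simp
    \<comment> \<open>Eigenvalues come with nonzero eigenvectors, but item 2 asks for unit
      ones.\<close>
    have normalize: "\<exists>x. eigenvector_on (Ran (P l)) (block N (P l)) c x \<and> norm x = 1"
      if l: "l \<in> {1..m}" and c: "eigenvalue_on (Ran (P l)) (block N (P l)) c" for l c
    proof -
      obtain x where x: "eigenvector_on (Ran (P l)) (block N (P l)) c x"
        using c by (auto simp: eigenvalue_on_def)
      have nx: "norm x > 0" using x by (simp add: eigenvector_on_def)
      define y where "y = complex_of_real (1 / norm x) *s x"
      have y: "y = (1 / norm x) *\<^sub>R x"
        by (simp add: y_def vec_eq_iff) (simp add: scaleR_conv_of_real)
      have "norm y = 1" using nx by (simp add: y)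
      moreover have "eigenvector_on (Ran (P l)) (block N (P l)) c y"
        using x \<open>norm y = 1\<close> unfolding eigvec[OF l]
        by (auto simp: y_def vector_scalar_commute vector_smult_assoc mult.commute)
      ultimately show ?thesis by blast
    qed
    obtain e f where e: "eigenvector_on (Ran (P k)) (block N (P k)) (complex_of_real a) e"
        "norm e = 1"
      and f: "eigenvector_on (Ran (P j)) (block N (P j)) (complex_of_real a) f" "norm f = 1"
      using normalize[OF kj(1) a] normalize[OF kj(2) b] by auto
    then obtain U where "exchanges U e f"
      using exchanges_ex1[OF e(2) f(2) orth[OF kj e(1) f(1)]] by blast
    then show False using item2[OF kj e f] face by blast
  qed
  have item4: "(\<exists>Y\<in>skew_hermitian. trace_inner (U ** N ** conj_transpose U) Y \<noteq> trace_inner N Y)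
      \<and> norming_functional nrm (trace_inner (U ** N ** conj_transpose U)) V"
    if s: "s \<in> {1..m}" and ab: "a \<noteq> b"
      and e: "eigenvector_on (Ran (P s)) (block N (P s)) (complex_of_real a) e" "norm e = 1"
      and f: "eigenvector_on (Ran (P s)) (block N (P s)) (complex_of_real b) f" "norm f = 1"
      and U: "exchanges U e f" for s e f U and a b :: real
  proof
    note e' = e(1)[unfolded eigvec[OF s]] and f' = f(1)[unfolded eigvec[OF s]]
    \<comment> \<open>\<open>D\<close> serves as the test matrix: the two functionals differ on it
      by \<open>D \<bullet> D\<close>.\<close>
    define D where "D = U ** N ** conj_transpose U - N"
    have "\<i> * complex_of_real a \<noteq> \<i> * complex_of_real b" using ab by simp
    then have "D \<noteq> 0"
      using exchanges_conjugation_neq[of N e _ f] e' f' f(2) U by (auto simp: D_def)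
    then have "(U ** N ** conj_transpose U) \<bullet> D - N \<bullet> D \<noteq> 0"
      unfolding inner_diff_left[symmetric] D_def[symmetric] by simp
    then have "trace_inner (U ** N ** conj_transpose U) D \<noteq> trace_inner N D"
      by (simp add: trace_inner_eq_inner)
    moreover have "D \<in> skew_hermitian"
      unfolding D_def by (intro skew_hermitian_closed(2) skew_hermitian_conjugation N)
    ultimately show "\<exists>Y\<in>skew_hermitian.
        trace_inner (U ** N ** conj_transpose U) Y \<noteq> trace_inner N Y" by blast
    \<comment> \<open>Orthogonality comes from \<open>N\<close>, since \<open>e\<close> and
      \<open>f\<close> share an eigenspace of \<open>V\<close>; that shared eigenvalue is why
      \<open>U\<close> fixes \<open>V\<close>.\<close>
    have "hermitian_inner e f = 0"
      using skew_hermitian_eigenvectors_orthogonal[OF N(1)] e' f' ab by blast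
    then have "U ** V ** conj_transpose U = V"
      using exchanges_conjugation_eq[OF V] e' f' e(2) f(2) U by blast
    then show "norming_functional nrm (trace_inner (U ** N ** conj_transpose U)) V"
      using norming_functional_conjugation[OF F N V] U by (simp add: exchanges_def)
  qed
  have item5: "\<exists>n :: nat \<Rightarrow> real. N = \<i> *\<^sub>M (\<Sum>k=1..m. n k *\<^sub>R P k) \<and>
      (\<forall>k\<in>{1..<m}. n k \<ge> n (k + 1))"
    if unique: "\<forall>\<psi>. norming_functional nrm \<psi> V \<longrightarrow> (\<forall>Y\<in>skew_hermitian. \<psi> Y = trace_inner N Y)"
  proof -
    obtain n where n: "N = \<i> *\<^sub>M (\<Sum>k=1..m. n k *\<^sub>R P k)"
      and ev: "\<And>k. k \<in> {1..m} \<Longrightarrow> eigenvalue_on (Ran (P k)) (block N (P k)) (complex_of_real (n k))"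
      using norming_functional_unique_diagonal[OF F V S N unique] by blast
    \<comment> \<open>Item 1 for the blocks \<open>k\<close> and \<open>k + 1\<close>; the half-open
      range keeps \<open>k + 1\<close> within \<open>{1..m}\<close>.\<close>
    have "\<forall>k\<in>{1..<m}. n k \<ge> n (k + 1)"
      by (intro ballI item1[OF _ _ _ ev ev]) auto
    then show ?thesis using n by blast
  qed
  have item6: "\<exists>n :: nat \<Rightarrow> real. N = \<i> *\<^sub>M (\<Sum>k=1..m. n k *\<^sub>R P k) \<and>
      (\<forall>k\<in>{1..<m}. n k > n (k + 1))"
    if "strictly_convex_norm nrm" "smooth_norm nrm"
  proof -
    \<comment> \<open>Smoothness yields uniqueness and hence the diagonal form; strict convexity
      yields the one-point face and hence strict inequalities by item 3.\<close>
    have unique: "\<forall>\<psi>. norming_functional nrm \<psi> V \<longrightarrow>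
        (\<forall>Y\<in>skew_hermitian. \<psi> Y = trace_inner N Y)"
      using smooth_norm_norming_functional_unique[OF F that(2) V assms(3) N(2)] by blast
    have face: "face nrm (trace_inner N) V = {V}"
      using strictly_convex_norm_face[OF F that(1) V assms(3) N(2)] .
    obtain n where n: "N = \<i> *\<^sub>M (\<Sum>k=1..m. n k *\<^sub>R P k)"
      and ev: "\<And>k. k \<in> {1..m} \<Longrightarrow> eigenvalue_on (Ran (P k)) (block N (P k)) (complex_of_real (n k))"
      using norming_functional_unique_diagonal[OF F V S N unique] by blast
    have "\<forall>k\<in>{1..<m}. n k > n (k + 1)"
      by (intro ballI item3[OF face _ _ _ ev ev]) auto
    then show ?thesis using n by blast
  qed
  show ?thesis
    by (intro conjI ballI allI impI sum; (elim conjE)?;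
        (rule item1 item3 item5 item6 item2[THEN conjunct1] item2[THEN conjunct2]
          item4[THEN conjunct1] item4[THEN conjunct2]; assumption))
qed

end
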